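(* Let $\mathcal{A}$ be a semi-quantum automaton, i.e. a CL-1QFA, a 1QFAC or a 1QCFA, with $q$ quantum basis states and $k$ classical states. Suppose that $\mathcal{A}$ recognizes, with cut-point isolated by $\delta$, a regular language whose minimal DFA has $d$ states. Then $$qk\;\geq\;\left[\frac{\log d}{2\log\frac{2}{\delta}}\right]^{\frac{4}{9}}.$$
   Context: For a finite set $Q$, $\mathcal{H}_Q$ denotes the complex Hilbert space with orthonormal basis $\{|p\rangle : p\in Q\}$. All Hilbert spaces are finite-dimensional. A projective measurement on $\mathcal{H}_Q$ is a finite family $\{P_c\}$ of mutually orthogonal orthogonal projectors with $\sum_c P_c=I$. A general measurement on $\mathcal{H}_Q$ with outcome set $\mathcal{C}$ is a family $\{M^c\}_{c\in\mathcal{C}}$ of linear operators on $\mathcal{H}_Q$ with $\sum_{c}(M^c)^\dagger M^c=I$. Ordered products are $\prod_{i=1}^n A_i=A_nA_{n-1}\cdots A_1$. DFA: a tuple $(S,\Sigma,s_1,\tau,S_a)$ with finite state set $S$, finite alphabet $\Sigma$, initial state $s_1\in S$, (total) transition function $\tau:S\times\Sigma\to S$ and accepting states $S_a\subseteq S$; it accepts $x\in\Sigma^*$ if the state reached from $s_1$ after reading $x$ lies in $S_a$. CL-1QFA: a tuple $(Q,\Sigma,\mathcal{C},q_1,\{U_\sigma\}_{\sigma\in\Sigma},\mathcal{M},\mathcal{L})$, where $Q$ is a finite set of quantum basis states, $\Sigma$ is a finite alphabet, $\mathcal{C}$ is a finite set of measurement outcomes, $q_1\in Q$, each $U_\sigma$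 is a unitary operator on $\mathcal{H}_Q$, $\mathcal{M}=\{P_c\}_{c\in\mathcal{C}}$ is a projective measurement on $\mathcal{H}_Q$, and $\mathcal{L}\subseteq\mathcal{C}^*$ is a regular language (the control language). The acceptance probability of $x=x_1\cdots x_n\in\Sigma^*$ is $$\mathcal{P}_{\mathcal{A}}(x)=\sum_{y_1\cdots y_n\in\mathcal{L}}\Big\|\prod_{i=1}^n(P_{y_i}U_{x_i})|q_1\rangle\Big\|^2 ,$$ the sum being over words of $\mathcal{L}$ of length $n$. Its number of quantum basis states is $q=|Q|$, and its number of classical states $k$ is the number of states of the minimal DFA accepting $\mathcal{L}$. 1QFAC: a tuple $(Q,S,\Sigma,q_1,s_1,\{U_{s,\sigma}\}_{s\in S,\sigma\in\Sigma},\tau,\{\mathcal{M}_s\}_{s\in S})$, where $Q$, $S$ are finite sets of quantum basis states and classical states, $\Sigma$ is a finite alphabet, $q_1\in Q$, $s_1\in S$, each $U_{s,\sigma}$ is a unitary operator on $\mathcal{H}_Q$, $\tau:S\times\Sigma\to S$, and each $\mathcal{M}_s=\{P_{s,a},P_{s,r}\}$ is a projective measurement on $\mathcal{H}_Q$ (outcomes: accept $a$, reject $r$). The acceptance probability of $x=x_1\cdots x_n$ is $$\mathcal{P}_{\mathcal{A}}(x)=\|P_{s_{n+1},a}U_{s_n,x_n}\cdots U_{s_2,x_2}U_{s_1,x_1}|q_1\rangle\|^2,\qquad s_{i+1}=\tau(s_i,x_i).$$ Here $q=|Q|$ and $k=|S|$. 1QCFA: a tuple $(Q,S,\Sigma,\mathcal{C},q_1,s_1,\{\Theta_{s,\sigma}\}_{s\in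 S,\sigma\in\Sigma},\tau,S_a)$, where $Q$, $S$ are finite sets of quantum basis states and classical states, $\Sigma$ is a finite alphabet, $\mathcal{C}$ is a finite set of measurement outcomes, $q_1\in Q$, $s_1\in S$, each $\Theta_{s,\sigma}=\{M^c_{s,\sigma}\}_{c\in\mathcal{C}}$ is a general measurement on $\mathcal{H}_Q$ with outcome set $\mathcal{C}$, $\tau:S\times\Sigma\times\mathcal{C}\to S$, and $S_a\subseteq S$. The acceptance probability of $x=x_1\cdots x_n$ is $$\mathcal{P}_{\mathcal{A}}(x)=\sum_{c_1\cdots c_n\in\mathcal{C}^n}\chi_a(s_{n+1})\,\|M^{c_n}_{s_n,x_n}\cdots M^{c_2}_{s_2,x_2}M^{c_1}_{s_1,x_1}|q_1\rangle\|^2,\qquad s_{i+1}=\tau(s_i,x_i,c_i),$$ where $\chi_a(s)=1$ if $s\in S_a$ and $0$ otherwise. Here $q=|Q|$ and $k=|S|$. Recognition: a language $L\subseteq\Sigma^*$ is recognized by $\mathcal{A}$ with cut-point isolated by $\delta$, where $\delta\in(0,\frac12]$, if there is $\lambda\in(0,1]$ such that $\mathcal{P}_{\mathcal{A}}(x)>\lambda$ for all $x\in L$, $\mathcal{P}_{\mathcal{A}}(x)\le\lambda$ for all $x\notin L$, and $|\mathcal{P}_{\mathcal{A}}(x)-\lambda|\ge\delta$ for all $x\in\Sigma^*$. *)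

theory Defs
  imports "HOL-Analysis.Analysis"
begin

record ('s, 'a) dfa =
  dfa_states :: "'s set"
  dfa_alphabet :: "'a set"
  dfa_init :: 's
  dfa_trans :: "'s \<Rightarrow> 'a \<Rightarrow> 's"
  dfa_accepting :: "'s set"

definition is_dfa :: "('s, 'a) dfa \<Rightarrow> bool" where
  "is_dfa D \<longleftrightarrow>
     finite (dfa_states D) \<and> finite (dfa_alphabet D) \<and>
     dfa_init D \<in> dfa_states D \<and>
     (\<forall>s \<in> dfa_states D. \<forall>a \<in> dfa_alphabet D. dfa_trans D s a \<in> dfa_states D) \<and>
     dfa_accepting D \<subseteq> dfa_states D"

definition dfa_language :: "('s, 'a) dfa \<Rightarrow> 'a list set" where
  "dfa_language D =
     {x \<in> lists (dfa_alphabet D). foldl (dfa_trans D) (dfa_init D) x \<in> dfa_accepting D}"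

text \<open>
  Finite state sets can be renamed to sets of natural numbers, so state type \<open>nat\<close> suffices
  below. All automata are complete, so a dead state, if needed, is counted.
\<close>

definition regular_over :: "'a set \<Rightarrow> 'a list set \<Rightarrow> bool" where
  "regular_over \<Sigma> L \<longleftrightarrow>
     (\<exists>D :: (nat, 'a) dfa. is_dfa D \<and> dfa_alphabet D = \<Sigma> \<and> dfa_language D = L)"

text \<open>The number of states of a minimal DFA; unspecified unless \<open>regular_over \<Sigma> L\<close>.\<close>

definition min_dfa_states :: "'a set \<Rightarrow> 'a list set \<Rightarrow> nat" where
  "min_dfa_states \<Sigma> L =
     (LEAST n. \<exists>D :: (nat, 'a) dfa.
        is_dfa D \<and> dfa_alphabet D = \<Sigma> \<and> dfa_language D = L \<and> card (dfa_states D) = n)"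

text \<open>
  The set of quantum basis states is a finite type \<open>'q\<close>; the Hilbert space is \<open>complex ^ 'q\<close>,
  whose library norm is the usual Hermitian one, and operators are square matrices over \<open>'q\<close>.
\<close>

abbreviation ket :: "'q::finite \<Rightarrow> complex ^ 'q" where
  "ket p \<equiv> axis p 1"

definition dagger :: "complex ^ 'q ^ 'q \<Rightarrow> complex ^ 'q ^ 'q" where
  "dagger A = (\<chi> i j. cnj (A $ j $ i))"

definition unitary_op :: "complex ^ 'q ^ 'q \<Rightarrow> bool" where
  "unitary_op U \<longleftrightarrow> dagger U ** U = mat 1 \<and> U ** dagger U = mat 1"

definition orthogonal_projector :: "complex ^ 'q ^ 'q \<Rightarrow> bool" where
  "orthogonal_projector P \<longleftrightarrow> P ** P = P \<and> dagger P = P"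

definition projective_measurement :: "'c set \<Rightarrow> ('c \<Rightarrow> complex ^ 'q ^ 'q) \<Rightarrow> bool" where
  "projective_measurement C P \<longleftrightarrow>
     finite C \<and> (\<forall>c \<in> C. orthogonal_projector (P c)) \<and>
     (\<forall>c \<in> C. \<forall>c' \<in> C. c \<noteq> c' \<longrightarrow> P c ** P c' = 0) \<and>
     (\<Sum>c\<in>C. P c) = mat 1"

definition general_measurement :: "'c set \<Rightarrow> ('c \<Rightarrow> complex ^ 'q ^ 'q) \<Rightarrow> bool" where
  "general_measurement C M \<longleftrightarrow> finite C \<and> (\<Sum>c\<in>C. dagger (M c) ** M c) = mat 1"

text \<open>The first operator of the list acts first, i.e. it is the rightmost factor.\<close>

primrec ordered_prod :: "(complex ^ 'q ^ 'q) list \<Rightarrow> complex ^ 'q ^ 'q" where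
  "ordered_prod [] = mat 1"
| "ordered_prod (A # As) = ordered_prod As ** A"

record ('q, 'a, 'c) cl_qfa =
  cl_alphabet :: "'a set"
  cl_outcomes :: "'c set"
  cl_init :: 'q
  cl_unitary :: "'a \<Rightarrow> complex ^ 'q ^ 'q"
  cl_proj :: "'c \<Rightarrow> complex ^ 'q ^ 'q"
  cl_control :: "'c list set"

definition is_cl_qfa :: "('q::finite, 'a, 'c) cl_qfa \<Rightarrow> bool" where
  "is_cl_qfa A \<longleftrightarrow>
     finite (cl_alphabet A) \<and> finite (cl_outcomes A) \<and>
     (\<forall>\<sigma> \<in> cl_alphabet A. unitary_op (cl_unitary A \<sigma>)) \<and>
     projective_measurement (cl_outcomes A) (cl_proj A) \<and>
     regular_over (cl_outcomes A) (cl_control A)"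

definition cl_prob :: "('q::finite, 'a, 'c) cl_qfa \<Rightarrow> 'a list \<Rightarrow> real" where
  "cl_prob A x =
     (\<Sum>y | y \<in> cl_control A \<and> length y = length x.
        (norm (ordered_prod (map2 (\<lambda>c \<sigma>. cl_proj A c ** cl_unitary A \<sigma>) y x)
               *v ket (cl_init A)))\<^sup>2)"

datatype verdict = Accept | Reject

record ('q, 's, 'a) qfac =
  qfac_states :: "'s set"
  qfac_alphabet :: "'a set"
  qfac_qinit :: 'q
  qfac_init :: 's
  qfac_unitary :: "'s \<Rightarrow> 'a \<Rightarrow> complex ^ 'q ^ 'q"
  qfac_trans :: "'s \<Rightarrow> 'a \<Rightarrow> 's"
  qfac_proj :: "'s \<Rightarrow> verdict \<Rightarrow> complex ^ 'q ^ 'q"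

definition is_qfac :: "('q::finite, 's, 'a) qfac \<Rightarrow> bool" where
  "is_qfac A \<longleftrightarrow>
     finite (qfac_states A) \<and> finite (qfac_alphabet A) \<and>
     qfac_init A \<in> qfac_states A \<and>
     (\<forall>s \<in> qfac_states A. \<forall>\<sigma> \<in> qfac_alphabet A.
        unitary_op (qfac_unitary A s \<sigma>) \<and> qfac_trans A s \<sigma> \<in> qfac_states A) \<and>
     (\<forall>s \<in> qfac_states A. projective_measurement {Accept, Reject} (qfac_proj A s))"

text \<open>The state after reading \<open>i\<close> letters; this is \<open>s\<^sub>i\<^sub>+\<^sub>1\<close> when the initial state is \<open>s\<^sub>1\<close>.\<close>

definition qfac_run :: "('q::finite, 's, 'a) qfac \<Rightarrow> 'a list \<Rightarrow> nat \<Rightarrow> 's" where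
  "qfac_run A x i = foldl (qfac_trans A) (qfac_init A) (take i x)"

definition qfac_prob :: "('q::finite, 's, 'a) qfac \<Rightarrow> 'a list \<Rightarrow> real" where
  "qfac_prob A x =
     (norm ((qfac_proj A (qfac_run A x (length x)) Accept
             ** ordered_prod (map (\<lambda>i. qfac_unitary A (qfac_run A x i) (x ! i)) [0..<length x]))
            *v ket (qfac_qinit A)))\<^sup>2"

record ('q, 's, 'a, 'c) qcfa =
  qcfa_states :: "'s set"
  qcfa_alphabet :: "'a set"
  qcfa_outcomes :: "'c set"
  qcfa_qinit :: 'q
  qcfa_init :: 's
  qcfa_meas :: "'s \<Rightarrow> 'a \<Rightarrow> 'c \<Rightarrow> complex ^ 'q ^ 'q"
  qcfa_trans :: "'s \<Rightarrow> 'a \<Rightarrow> 'c \<Rightarrow> 's"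
  qcfa_accepting :: "'s set"

definition is_qcfa :: "('q::finite, 's, 'a, 'c) qcfa \<Rightarrow> bool" where
  "is_qcfa A \<longleftrightarrow>
     finite (qcfa_states A) \<and> finite (qcfa_alphabet A) \<and> finite (qcfa_outcomes A) \<and>
     qcfa_init A \<in> qcfa_states A \<and>
     (\<forall>s \<in> qcfa_states A. \<forall>\<sigma> \<in> qcfa_alphabet A.
        general_measurement (qcfa_outcomes A) (qcfa_meas A s \<sigma>) \<and>
        (\<forall>c \<in> qcfa_outcomes A. qcfa_trans A s \<sigma> c \<in> qcfa_states A)) \<and>
     qcfa_accepting A \<subseteq> qcfa_states A"

definition qcfa_run :: "('q::finite, 's, 'a, 'c) qcfa \<Rightarrow> 'a list \<Rightarrow> 'c list \<Rightarrow> nat \<Rightarrow> 's" where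
  "qcfa_run A x cs i =
     foldl (\<lambda>s (\<sigma>, c). qcfa_trans A s \<sigma> c) (qcfa_init A) (take i (zip x cs))"

definition qcfa_prob :: "('q::finite, 's, 'a, 'c) qcfa \<Rightarrow> 'a list \<Rightarrow> real" where
  "qcfa_prob A x =
     (\<Sum>cs | cs \<in> lists (qcfa_outcomes A) \<and> length cs = length x.
        indicator (qcfa_accepting A) (qcfa_run A x cs (length x)) *
        (norm (ordered_prod
                 (map (\<lambda>i. qcfa_meas A (qcfa_run A x cs i) (x ! i) (cs ! i)) [0..<length x])
               *v ket (qcfa_qinit A)))\<^sup>2)"

datatype ('q, 's, 'a, 'c) semi_quantum =
    CL_1QFA "('q, 'a, 'c) cl_qfa"
  | QFAC "('q, 's, 'a) qfac"
  | QCFA "('q, 's, 'a, 'c) qcfa"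

primrec is_semi_quantum :: "('q::finite, 's, 'a, 'c) semi_quantum \<Rightarrow> bool" where
  "is_semi_quantum (CL_1QFA A) = is_cl_qfa A"
| "is_semi_quantum (QFAC A) = is_qfac A"
| "is_semi_quantum (QCFA A) = is_qcfa A"

primrec sq_alphabet :: "('q::finite, 's, 'a, 'c) semi_quantum \<Rightarrow> 'a set" where
  "sq_alphabet (CL_1QFA A) = cl_alphabet A"
| "sq_alphabet (QFAC A) = qfac_alphabet A"
| "sq_alphabet (QCFA A) = qcfa_alphabet A"

primrec accept_prob :: "('q::finite, 's, 'a, 'c) semi_quantum \<Rightarrow> 'a list \<Rightarrow> real" where
  "accept_prob (CL_1QFA A) = cl_prob A"
| "accept_prob (QFAC A) = qfac_prob A"
| "accept_prob (QCFA A) = qcfa_prob A"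

definition quantum_states :: "('q::finite, 's, 'a, 'c) semi_quantum \<Rightarrow> nat" where
  "quantum_states A = CARD('q)"

primrec classical_states :: "('q::finite, 's, 'a, 'c) semi_quantum \<Rightarrow> nat" where
  "classical_states (CL_1QFA A) = min_dfa_states (cl_outcomes A) (cl_control A)"
| "classical_states (QFAC A) = card (qfac_states A)"
| "classical_states (QCFA A) = card (qcfa_states A)"

definition recognizes_isolated ::
    "('q::finite, 's, 'a, 'c) semi_quantum \<Rightarrow> 'a list set \<Rightarrow> real \<Rightarrow> bool" where
  "recognizes_isolated A L \<delta> \<longleftrightarrow>
     0 < \<delta> \<and> \<delta> \<le> 1/2 \<and> L \<subseteq> lists (sq_alphabet A) \<and>
     (\<exists>cut. 0 < cut \<and> cut \<le> 1 \<and>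
        (\<forall>x \<in> L. accept_prob A x > cut) \<and>
        (\<forall>x \<in> lists (sq_alphabet A) - L. accept_prob A x \<le> cut) \<and>
        (\<forall>x \<in> lists (sq_alphabet A). \<bar>accept_prob A x - cut\<bar> \<ge> \<delta>))"

end

theory Submission
  imports Defs
begin

text \<open>
  After reading \<open>x\<close>, a semi-quantum automaton is described by one (unnormalized) density matrix per
  classical state, and the probability of accepting \<open>x @ z\<close> is a linear functional, depending only
  on \<open>z\<close>, of this family. Hence \<open>P (x @ z) = \<langle>\<psi> x, \<phi> z\<rangle>\<close> in real dimension
  \<open>N = 2 * k * q\<^sup>2\<close>, with values in \<open>[0, 1]\<close>. Words \<open>x\<close>, \<open>y\<close> with different residual
  languages are separated by some \<open>z\<close> with \<open>\<bar>P (x @ z) - P (y @ z)\<bar> \<ge> 2 * \<delta>\<close>.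

  The number \<open>d\<close> of such words is bounded by amplification: put \<open>t = \<delta> / 2\<close>. The \<open>d ^ m\<close> vectors
  \<open>\<psi> x\<^sub>0 + t * \<psi> x\<^sub>1 + \<dots> + t ^ (m - 1) * \<psi> x\<^sub>m\<^sub>-\<^sub>1\<close> are bounded and still separated by the
  functionals, at distance at least of order \<open>t ^ m\<close>. A grid of that mesh has \<open>O((1 / t) ^ (m * N))\<close> cells, so
  letting \<open>m\<close> grow gives \<open>d \<le> (2 / \<delta>) ^ N\<close>.
\<close>

subsection \<open>Separated rows of a matrix of bounded rank\<close>

text \<open>If \<open>a\<close> exceeded \<open>b\<close>, then \<open>(a / b) ^ m\<close> would
  outgrow any constant. The constant of a counting bound for \<open>m\<close>-fold words can
  therefore be dropped.\<close>

lemma le_if_powers_le: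
  fixes a b K :: real
  assumes "0 < b" and le: "\<And>m::nat. a ^ m \<le> K * b ^ m"
  shows "a \<le> b"
proof (rule ccontr)
  assume "\<not> a \<le> b"
  then have "1 < a / b" using assms(1) by simp
  then obtain m where "K < (a / b) ^ m" using real_arch_pow by blast
  then have "K * b ^ m < a ^ m"
    using assms(1) by (simp add: power_divide field_simps)
  then show False using le[of m] by simp
qed

lemma abs_le_double_sum:
  fixes f :: "'c \<Rightarrow> 'i \<Rightarrow> real"
  assumes "finite A" "finite I" "a \<in> A" "i \<in> I"
  shows "\<bar>f a i\<bar> \<le> (\<Sum>a\<in>A. \<Sum>i\<in>I. \<bar>f a i\<bar>)"
proof -
  have "\<bar>f a i\<bar> \<le> (\<Sum>i\<in>I. \<bar>f a i\<bar>)" by (rule member_le_sum) (use assms in auto)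
  also have "\<dots> \<le> (\<Sum>a\<in>A. \<Sum>i\<in>I. \<bar>f a i\<bar>)"
    by (rule member_le_sum[of a A "\<lambda>a. \<Sum>i\<in>I. \<bar>f a i\<bar>"])
      (use assms in \<open>auto intro: sum_nonneg\<close>)
  finally show ?thesis .
qed

text \<open>\<open>P\<close> is a matrix factored through dimension \<open>card I\<close>. A direct
  grid count for its rows would depend on the size of the factors \<open>\<psi>\<close> and
  \<open>\<phi>\<close>, about which nothing is assumed. Passing to words of length \<open>m\<close>
  pushes this dependence into a constant independent of \<open>m\<close>.\<close>

lemma separated_rows_bound:
  fixes \<psi> :: "'x \<Rightarrow> 'i \<Rightarrow> real" and \<phi> :: "'z \<Rightarrow> 'i \<Rightarrow> real" and \<delta> :: real
  assumes "finite X" "finite Z" "finite I" "0 < \<delta>" "\<delta> \<le> 1/2"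
    and P: "\<And>x z. x \<in> X \<Longrightarrow> z \<in> Z \<Longrightarrow> P x z = (\<Sum>i\<in>I. \<psi> x i * \<phi> z i)"
    and range: "\<And>x z. x \<in> X \<Longrightarrow> z \<in> Z \<Longrightarrow> 0 \<le> P x z \<and> P x z \<le> 1"
    and sep: "\<And>x y. x \<in> X \<Longrightarrow> y \<in> X \<Longrightarrow> x \<noteq> y \<Longrightarrow> \<exists>z\<in>Z. 2 * \<delta> \<le> \<bar>P x z - P y z\<bar>"
  shows "real (card X) \<le> (2 / \<delta>) ^ card I"
proof -
  \<comment> \<open>With this weight, and tails in \<open>[0, 4/3]\<close>, two tails differ by at
    most \<open>t * (4/3)\<close>, that is 2/3 of \<delta>. This cannot cancel a gap of
    \<open>2 * \<delta>\<close> in the first letter.\<close>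
  define t where "t = \<delta> / 2"
  have t: "0 < t" "t \<le> 1/4" using assms by (auto simp: t_def)
  \<comment> \<open>Horner form of the weighted sum: the first letter has weight 1, so the recursion
    follows the list.\<close>
  define val where "val w i = foldr (\<lambda>x r. \<psi> x i + t * r) w 0" for w i
  define p where "p w z = (\<Sum>i\<in>I. val w i * \<phi> z i)" for w z
  have val_simps: "val [] i = 0" "val (x # w) i = \<psi> x i + t * val w i" for x w i
    by (simp_all add: val_def)
  have p_Nil: "p [] z = 0" for z by (simp add: p_def val_simps)
  have p_Cons: "p (x # w) z = P x z + t * p w z" if "x \<in> X" "z \<in> Z" for x w z
    using that
    by (simp add: p_def val_simps P distrib_right sum.distrib sum_distrib_left mult.assoc)
  \<comment> \<open>The bound 4/3 is the geometric series with ratio 1/4, the fixed point of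
    \<open>1 + r / 4\<close>.\<close>
  have p_range: "0 \<le> p w z \<and> p w z \<le> 4/3" if "w \<in> lists X" "z \<in> Z" for w z
    using that(1)
  proof induction
    case Nil
    then show ?case by (simp add: p_Nil)
  next
    case (Cons x w)
    have "t * p w z \<le> 1/4 * (4/3)"
      by (rule mult_mono) (use t Cons in auto)
    moreover have "0 \<le> t * p w z" using t Cons by simp
    ultimately show ?case using range[OF Cons(1) that(2)] p_Cons[OF Cons(1) that(2)] by simp
  qed
  \<comment> \<open>The first differing letter decides: each common letter before it costs a factor
    \<open>t\<close>, and at that letter a gap of at least \<delta> survives the tails.\<close>
  have p_sep: "\<exists>z\<in>Z. \<delta> * t ^ length w \<le> \<bar>p w z - p w' z\<bar>"
    if "length w = length w'" "w \<in> lists X" "w' \<in> lists X" "w \<noteq> w'" for w w'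
    using that
  proof (induction w w' rule: list_induct2)
    case Nil
    then show ?case by simp
  next
    case (Cons x w y w')
    have tm: "t * t ^ length w \<le> 1" using t by (simp add: mult_le_one power_le_one)
    show ?case
    proof (cases "x = y")
      case True
      then obtain z where z: "z \<in> Z" "\<delta> * t ^ length w \<le> \<bar>p w z - p w' z\<bar>"
        using Cons by auto
      have "\<bar>p (x # w) z - p (y # w') z\<bar> = t * \<bar>p w z - p w' z\<bar>"
        using True Cons.prems z t by (simp add: p_Cons abs_mult flip: right_diff_distrib)
      then show ?thesis using z t by (intro bexI[of _ z]) auto
    next
      case False
      then obtain z where z: "z \<in> Z" "2 * \<delta> \<le> \<bar>P x z - P y z\<bar>"
        using sep[of x y] Cons.prems by auto
      have "0 \<le> p w z \<and> p w z \<le> 4/3" "0 \<le> p w' z \<and> p w' z \<le> 4/3"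
        using p_range Cons.prems z by auto
      then have "\<bar>p w z - p w' z\<bar> \<le> 4/3" by linarith
      then have "\<bar>t * p w z - t * p w' z\<bar> \<le> t * (4/3)"
        using t by (simp add: abs_mult flip: right_diff_distrib)
      moreover have "t * (4/3) \<le> \<delta>" using \<open>0 < \<delta>\<close> by (simp add: t_def)
      ultimately have "\<delta> \<le> \<bar>p (x # w) z - p (y # w') z\<bar>"
        using z p_Cons[of x z w] p_Cons[of y z w'] Cons.prems
        unfolding Cons_in_lists_iff by linarith
      moreover have "\<delta> * (t * t ^ length w) \<le> \<delta> * 1"
        using tm \<open>0 < \<delta>\<close> by (intro mult_left_mono) auto
      ultimately show ?thesis using z(1) by force
    qed
  qed
  \<comment> \<open>A crude common bound for all coordinates, available because the index sets are
    finite. Its size is harmless, as it ends up in the constant \<open>A\<close>.\<close>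
  define B where "B = 1 + (\<Sum>x\<in>X. \<Sum>i\<in>I. \<bar>\<psi> x i\<bar>) + (\<Sum>z\<in>Z. \<Sum>i\<in>I. \<bar>\<phi> z i\<bar>)"
  have nn: "0 \<le> (\<Sum>x\<in>X. \<Sum>i\<in>I. \<bar>\<psi> x i\<bar>)" "0 \<le> (\<Sum>z\<in>Z. \<Sum>i\<in>I. \<bar>\<phi> z i\<bar>)"
    by (auto intro!: sum_nonneg)
  have B: "1 \<le> B" using nn by (simp add: B_def)
  have \<psi>B: "\<bar>\<psi> x i\<bar> \<le> B" if "x \<in> X" "i \<in> I" for x i
    using abs_le_double_sum[OF \<open>finite X\<close> \<open>finite I\<close> that, of \<psi>] nn by (simp add: B_def)
  have \<phi>B: "\<bar>\<phi> z i\<bar> \<le> B" if "z \<in> Z" "i \<in> I" for z i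
    using abs_le_double_sum[OF \<open>finite Z\<close> \<open>finite I\<close> that, of \<phi>] nn by (simp add: B_def)
  have val_le: "\<bar>val w i\<bar> \<le> 2 * B" if "w \<in> lists X" "i \<in> I" for w i
    using that(1)
  proof induction
    case Nil
    then show ?case using B by (simp add: val_simps)
  next
    case (Cons x w)
    have "t * \<bar>val w i\<bar> \<le> 1/4 * (2 * B)"
      by (rule mult_mono) (use t Cons B in auto)
    then have "\<bar>t * val w i\<bar> \<le> B / 2" using t by (simp add: abs_mult)
    then show ?case using \<psi>B[OF Cons(1) that(2)] B by (simp add: val_simps)
  qed
  \<comment> \<open>Chosen so that \<open>4 * B / h + 3\<close>, which bounds the number of cells
    per coordinate, is at most \<open>A / t ^ m\<close>; the summand 3 is absorbed because
    \<open>t ^ m\<close> is at most 1.\<close>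
  define A where "A = 4 * B * (card I * B + 1) / \<delta> + 3"
  have "real (card X) ^ m \<le> A ^ card I * ((2 / \<delta>) ^ card I) ^ m" for m
  proof -
    define W where "W = {w. set w \<subseteq> X \<and> length w = m}"
    have W: "w \<in> lists X" "length w = m" if "w \<in> W" for w
      using that by (auto simp: W_def)
    \<comment> \<open>The mesh: words in one cell have values differing by at most
      \<open>card I * h * B\<close>. The extra 1 makes this strictly less than the separation
      \<open>\<delta> * t ^ m\<close> and keeps the denominator positive for empty
      \<open>I\<close>.\<close>
    define h where "h = \<delta> * t ^ m / (card I * B + 1)"
    have den: "0 < real (card I) * B + 1" using B by (simp add: add_nonneg_pos)
    have h: "0 < h" using den t \<open>0 < \<delta>\<close> by (simp add: h_def)
    define K where "K = \<lceil>2 * B / h\<rceil>"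
    have "0 \<le> 2 * B / h" using B h by simp
    then have K: "0 \<le> K" unfolding K_def by linarith
    \<comment> \<open>The grid cell of \<open>w\<close>. The restriction puts it into the
      extensional function space, whose cardinality is a power.\<close>
    define g where "g w = restrict (\<lambda>i. \<lfloor>val w i / h\<rfloor>) I" for w
    have "inj_on g W"
    proof (rule inj_onI, rule ccontr)
      fix w w' assume w: "w \<in> W" "w' \<in> W" "g w = g w'" "w \<noteq> w'"
      then have "\<exists>z\<in>Z. \<delta> * t ^ length w \<le> \<bar>p w z - p w' z\<bar>"
        by (intro p_sep) (simp_all add: W)
      then obtain z where z: "z \<in> Z" "\<delta> * t ^ m \<le> \<bar>p w z - p w' z\<bar>"
        using W(2)[OF w(1)] by blast
      have close: "\<bar>val w i - val w' i\<bar> \<le> h" if "i \<in> I" for i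
      proof -
        have "\<lfloor>val w i / h\<rfloor> = \<lfloor>val w' i / h\<rfloor>"
          using fun_cong[OF w(3), of i] that by (simp add: g_def)
        then have "\<bar>val w i / h - val w' i / h\<bar> \<le> 1" by linarith
        then have "\<bar>(val w i - val w' i) / h\<bar> \<le> 1" by (simp only: diff_divide_distrib)
        then show ?thesis using h by (simp add: abs_divide pos_divide_le_eq)
      qed
      have "\<bar>p w z - p w' z\<bar> = \<bar>\<Sum>i\<in>I. (val w i - val w' i) * \<phi> z i\<bar>"
        by (simp add: p_def left_diff_distrib sum_subtractf)
      also have "\<dots> \<le> (\<Sum>i\<in>I. h * B)"
        by (rule order_trans[OF sum_abs], rule sum_mono)
          (use close \<phi>B z h in \<open>auto simp: abs_mult intro!: mult_mono\<close>)
      also have "\<dots> < h * (card I * B + 1)" using h by (simp add: algebra_simps)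
      also have "\<dots> = \<delta> * t ^ m" using den by (simp add: h_def)
      finally show False using z by simp
    qed
    moreover have "g ` W \<subseteq> I \<rightarrow>\<^sub>E {-K..K}"
    proof (intro image_subsetI PiE_I)
      fix w i assume "w \<in> W" "i \<in> I"
      have "\<bar>val w i\<bar> / h \<le> 2 * B / h"
        using val_le[OF W(1)[OF \<open>w \<in> W\<close>] \<open>i \<in> I\<close>] h by (intro divide_right_mono) auto
      also have "\<bar>val w i\<bar> / h = \<bar>val w i / h\<bar>" using h by (simp add: abs_divide)
      finally have "\<bar>val w i / h\<bar> \<le> of_int K" unfolding K_def by linarith
      then have "- K \<le> \<lfloor>val w i / h\<rfloor>" "\<lfloor>val w i / h\<rfloor> \<le> K" by linarith+
      then show "g w i \<in> {-K..K}" using \<open>i \<in> I\<close> by (simp add: g_def)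
    qed (simp add: g_def)
    moreover have "finite (I \<rightarrow>\<^sub>E {-K..K})" using \<open>finite I\<close> by (simp add: finite_PiE)
    ultimately have "card W \<le> card (I \<rightarrow>\<^sub>E {-K..K})" by (metis card_inj_on_le)
    also have "\<dots> = nat (2 * K + 1) ^ card I"
      using \<open>finite I\<close> by (simp add: card_PiE algebra_simps)
    finally have "real (card X ^ m) \<le> real (nat (2 * K + 1) ^ card I)"
      unfolding W_def of_nat_le_iff using card_lists_length_eq[OF \<open>finite X\<close>, of m] by simp
    then have 1: "real (card X) ^ m \<le> (real (nat (2 * K + 1))) ^ card I" by simp
    have "real (nat (2 * K + 1)) \<le> 4 * B / h + 3"
    proof -
      have "real_of_int K \<le> 2 * B / h + 1" unfolding K_def by linarith
      then show ?thesis using K by simp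
    qed
    also have "4 * B / h = 4 * B * (card I * B + 1) / \<delta> / t ^ m"
      by (simp add: h_def)
    also have "3 \<le> 3 / t ^ m"
      using t by (simp add: pos_le_divide_eq power_le_one)
    also have "4 * B * (card I * B + 1) / \<delta> / t ^ m + 3 / t ^ m = A * (2 / \<delta>) ^ m"
      unfolding A_def t_def by (simp add: power_divide add_divide_distrib distrib_right)
    finally have "real (nat (2 * K + 1)) ^ card I \<le> (A * (2 / \<delta>) ^ m) ^ card I"
      by (intro power_mono) auto
    then show ?thesis using 1
      by (simp add: power_mult_distrib mult.commute flip: power_mult)
  qed
  moreover have "0 < (2 / \<delta>) ^ card I" using \<open>0 < \<delta>\<close> by simp
  ultimately show ?thesis by (rule le_if_powers_le[rotated])
qed

subsection \<open>Minimal automata and residual languages\<close>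

text \<open>Myhill-Nerode: the residual languages are themselves the states of a DFA for
  \<open>L\<close>, so there are at least \<open>min_dfa_states \<Sigma> L\<close> of them.
  \<open>X\<close> takes one word from each residual class.\<close>

lemma distinguishable_words:
  assumes "regular_over \<Sigma> L"
  obtains X where "finite X" "X \<subseteq> lists \<Sigma>" "min_dfa_states \<Sigma> L \<le> card X"
    "\<And>x y. x \<in> X \<Longrightarrow> y \<in> X \<Longrightarrow> x \<noteq> y \<Longrightarrow>
       \<exists>z\<in>lists \<Sigma>. (x @ z \<in> L) \<noteq> (y @ z \<in> L)"
proof -
  obtain D :: "(nat, 'a) dfa" where D: "is_dfa D" "dfa_alphabet D = \<Sigma>" "dfa_language D = L"
    using assms by (auto simp: regular_over_def)
  define res where "res x = {z \<in> lists \<Sigma>. x @ z \<in> L}" for x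
  define R where "R = res ` lists \<Sigma>"
  have L: "L \<subseteq> lists \<Sigma>" using D by (auto simp: dfa_language_def)
  have state: "foldl (dfa_trans D) (dfa_init D) x \<in> dfa_states D" if "x \<in> lists \<Sigma>" for x
    using that
  proof (induction x rule: rev_induct)
    case Nil
    then show ?case using D by (simp add: is_dfa_def)
  next
    case (snoc a x)
    then show ?case using D by (simp add: is_dfa_def)
  qed
  \<comment> \<open>The residual of a word depends only on the state it reaches in \<open>D\<close>,
    so there are finitely many residuals.\<close>
  define h where "h s = {z \<in> lists \<Sigma>. foldl (dfa_trans D) s z \<in> dfa_accepting D}" for s
  have "res x = h (foldl (dfa_trans D) (dfa_init D) x)" if "x \<in> lists \<Sigma>" for x
    using that D unfolding res_def h_def dfa_language_def by auto
  then have "R \<subseteq> h ` dfa_states D" using state by (auto simp: R_def)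
  then have finR: "finite R"
    using D by (meson finite_imageI finite_subset is_dfa_def)
  \<comment> \<open>The residuals are numbered because \<open>min_dfa_states\<close> ranges over
    automata with states of type \<open>nat\<close>.\<close>
  obtain e where e: "bij_betw e R {0..<card R}"
    using ex_bij_betw_finite_nat[OF finR] by blast
  have eR: "e (res x) < card R" if "x \<in> lists \<Sigma>" for x
    using bij_betwE[OF e] that by (simp add: R_def)
  have inve: "inv_into R e (e (res x)) = res x" if "x \<in> lists \<Sigma>" for x
    using e that by (auto simp: bij_betw_def R_def intro!: inv_into_f_f)
  have res_snoc: "{z. a # z \<in> res x} = res (x @ [a])" if "a \<in> \<Sigma>" for x a
    using that by (auto simp: res_def)
  \<comment> \<open>The residual automaton: a letter acts by the left derivative, and a residual
    accepts if it contains the empty word.\<close>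
  define D' :: "(nat, 'a) dfa" where
    "D' = \<lparr>dfa_states = {0..<card R}, dfa_alphabet = \<Sigma>, dfa_init = e (res []),
           dfa_trans = (\<lambda>n a. e {z. a # z \<in> inv_into R e n}),
           dfa_accepting = e ` {r \<in> R. [] \<in> r}\<rparr>"
  have trans: "dfa_trans D' (e (res x)) a = e (res (x @ [a]))" if "x \<in> lists \<Sigma>" "a \<in> \<Sigma>" for x a
    using that by (simp add: D'_def inve res_snoc)
  have run: "foldl (dfa_trans D') (dfa_init D') x = e (res x)" if "x \<in> lists \<Sigma>" for x
    using that
  proof (induction x rule: rev_induct)
    case Nil
    then show ?case by (simp add: D'_def)
  next
    case (snoc a x)
    then show ?case using trans by simp
  qed
  have "is_dfa D'"
    unfolding is_dfa_def
  proof (intro conjI ballI)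
    show "finite (dfa_states D')" "finite (dfa_alphabet D')" "dfa_init D' \<in> dfa_states D'"
      using D eR by (auto simp: D'_def is_dfa_def)
    show "dfa_accepting D' \<subseteq> dfa_states D'"
      using e by (auto simp: D'_def bij_betw_def)
    fix s a assume s: "s \<in> dfa_states D'" and a: "a \<in> dfa_alphabet D'"
    have "s \<in> e ` R" using s e by (simp add: D'_def bij_betw_def)
    then obtain x where x: "x \<in> lists \<Sigma>" "s = e (res x)" by (auto simp: R_def)
    then show "dfa_trans D' s a \<in> dfa_states D'"
      using trans[of x a] a eR[of "x @ [a]"] by (simp add: D'_def)
  qed
  moreover have "dfa_language D' = L"
  proof -
    have "e (res x) \<in> e ` {r \<in> R. [] \<in> r} \<longleftrightarrow> x \<in> L" if "x \<in> lists \<Sigma>" for x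
    proof -
      have "e (res x) \<in> e ` {r \<in> R. [] \<in> r} \<longleftrightarrow> res x \<in> {r \<in> R. [] \<in> r}"
        by (rule inj_on_image_mem_iff[of e R]) (use e that in \<open>auto simp: bij_betw_def R_def\<close>)
      then show ?thesis using that by (auto simp: R_def res_def)
    qed
    then have "foldl (dfa_trans D') (dfa_init D') x \<in> dfa_accepting D' \<longleftrightarrow> x \<in> L"
      if "x \<in> lists \<Sigma>" for x
      using that by (simp add: run) (simp add: D'_def)
    then have "dfa_language D' = {x \<in> lists \<Sigma>. x \<in> L}"
      unfolding dfa_language_def by (auto simp: D'_def)
    then show ?thesis using L by auto
  qed
  ultimately have "min_dfa_states \<Sigma> L \<le> card R"
    unfolding min_dfa_states_def
    by (intro Least_le exI[of _ D']) (simp add: D'_def)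
  moreover define X where "X = inv_into (lists \<Sigma>) res ` R"
  moreover have "inj_on (inv_into (lists \<Sigma>) res) R"
    unfolding R_def by (rule inj_on_inv_into) simp
  ultimately have "min_dfa_states \<Sigma> L \<le> card X" by (simp add: card_image)
  moreover have XL: "X \<subseteq> lists \<Sigma>"
    unfolding X_def R_def using inv_into_into[of _ res "lists \<Sigma>"] by blast
  moreover have "\<exists>z\<in>lists \<Sigma>. (x @ z \<in> L) \<noteq> (y @ z \<in> L)"
    if "x \<in> X" "y \<in> X" "x \<noteq> y" for x y
  proof -
    \<comment> \<open>Each word of \<open>X\<close> is the chosen representative of its own
      residual, which makes \<open>res\<close> injective on \<open>X\<close>.\<close>
    have "inv_into (lists \<Sigma>) res (res x) = x" if "x \<in> X" for x
    proof -
      obtain r where "r \<in> R" "x = inv_into (lists \<Sigma>) res r" using \<open>x \<in> X\<close> by (auto simp: X_def)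
      then show ?thesis using f_inv_into_f[of r res "lists \<Sigma>"] by (simp add: R_def)
    qed
    then have "res x \<noteq> res y" using that by metis
    then show ?thesis by (auto simp: res_def)
  qed
  ultimately show thesis using that[of X] finR by (simp add: X_def)
qed

lemma minimal_dfa:
  assumes "regular_over \<Sigma> L"
  obtains D :: "(nat, 'a) dfa" where "is_dfa D" "dfa_alphabet D = \<Sigma>" "dfa_language D = L"
    "card (dfa_states D) = min_dfa_states \<Sigma> L"
proof -
  have "\<exists>n. \<exists>D :: (nat, 'a) dfa. is_dfa D \<and> dfa_alphabet D = \<Sigma> \<and> dfa_language D = L \<and>
      card (dfa_states D) = n"
    using assms by (auto simp: regular_over_def)
  from LeastI_ex[OF this] show thesis using that unfolding min_dfa_states_def by blast
qed

lemma is_dfa_card_pos: "is_dfa D \<Longrightarrow> 0 < card (dfa_states D)"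
  by (auto simp: is_dfa_def card_gt_0_iff)

subsection \<open>Quadratic forms and measurements\<close>

text \<open>The right-hand side is linear in the pure-state density matrix with entries
  \<open>v $ a * cnj (v $ b)\<close>. Acceptance probabilities are handled as such forms to make
  them linear in the state.\<close>

definition quadratic_form :: "(complex ^ 'q \<Rightarrow> real) \<Rightarrow> bool" where
  "quadratic_form f \<longleftrightarrow>
     (\<exists>E. \<forall>v. complex_of_real (f v) = (\<Sum>a\<in>UNIV. \<Sum>b\<in>UNIV. v $ a * cnj (v $ b) * E a b))"

lemma of_real_norm_vec_squared:
  fixes v :: "complex ^ 'q::finite"
  shows "complex_of_real ((norm v)\<^sup>2) = (\<Sum>a\<in>UNIV. v $ a * cnj (v $ a))"
proof -
  have "(norm v)\<^sup>2 = (\<Sum>a\<in>UNIV. (norm (v $ a))\<^sup>2)"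
    by (simp add: norm_vec_def L2_set_def sum_nonneg)
  then show ?thesis by (simp only: of_real_sum complex_norm_square)
qed

lemma quadratic_form_norm_squared: "quadratic_form (\<lambda>v :: complex ^ 'q::finite. (norm v)\<^sup>2)"
proof -
  have "complex_of_real ((norm v)\<^sup>2) =
      (\<Sum>a\<in>UNIV. \<Sum>b\<in>UNIV. v $ a * cnj (v $ b) * (if b = a then 1 else 0))"
    for v :: "complex ^ 'q"
    by (subst of_real_norm_vec_squared) (simp add: if_distrib cong: if_cong)
  then show ?thesis
    unfolding quadratic_form_def by (intro exI[of _ "\<lambda>a b. if b = a then 1 else 0"]) blast
qed

lemma quadratic_form_zero: "quadratic_form (\<lambda>v :: complex ^ 'q::finite. 0)"
  unfolding quadratic_form_def by (intro exI[of _ "\<lambda>_ _. 0"]) simp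

lemma quadratic_form_sum:
  fixes f :: "'c \<Rightarrow> complex ^ 'q::finite \<Rightarrow> real"
  assumes "\<And>c. c \<in> C \<Longrightarrow> quadratic_form (f c)"
  shows "quadratic_form (\<lambda>v. \<Sum>c\<in>C. f c v)"
proof -
  define E where "E c = (SOME E. \<forall>v. complex_of_real (f c v) =
      (\<Sum>a\<in>UNIV. \<Sum>b\<in>UNIV. v $ a * cnj (v $ b) * E a b))" for c
  have E: "complex_of_real (f c v) = (\<Sum>a\<in>UNIV. \<Sum>b\<in>UNIV. v $ a * cnj (v $ b) * E c a b)"
    if "c \<in> C" for c v
    using someI_ex[OF assms[OF that, unfolded quadratic_form_def]] unfolding E_def by blast
  have "complex_of_real (\<Sum>c\<in>C. f c v) =
      (\<Sum>a\<in>UNIV. \<Sum>b\<in>UNIV. v $ a * cnj (v $ b) * (\<Sum>c\<in>C. E c a b))" for v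
  proof -
    have "complex_of_real (\<Sum>c\<in>C. f c v) =
        (\<Sum>c\<in>C. \<Sum>a\<in>UNIV. \<Sum>b\<in>UNIV. v $ a * cnj (v $ b) * E c a b)"
      by (simp add: E)
    also have "\<dots> = (\<Sum>a\<in>UNIV. \<Sum>c\<in>C. \<Sum>b\<in>UNIV. v $ a * cnj (v $ b) * E c a b)"
      by (rule sum.swap)
    also have "\<dots> = (\<Sum>a\<in>UNIV. \<Sum>b\<in>UNIV. \<Sum>c\<in>C. v $ a * cnj (v $ b) * E c a b)"
      by (intro sum.cong refl sum.swap)
    finally show ?thesis by (simp add: sum_distrib_left)
  qed
  then show ?thesis unfolding quadratic_form_def
    by (intro exI[of _ "\<lambda>a b. \<Sum>c\<in>C. E c a b"]) blast
qed

lemma sum_swap_pairs: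
  "(\<Sum>a\<in>A. \<Sum>b\<in>B. \<Sum>i\<in>I. \<Sum>j\<in>J. f a b i j) =
   (\<Sum>i\<in>I. \<Sum>j\<in>J. \<Sum>a\<in>A. \<Sum>b\<in>B. f a b i j)"
proof -
  have "(\<Sum>a\<in>A. \<Sum>b\<in>B. \<Sum>i\<in>I. \<Sum>j\<in>J. f a b i j) =
      (\<Sum>a\<in>A. \<Sum>i\<in>I. \<Sum>j\<in>J. \<Sum>b\<in>B. f a b i j)"
    by (subst sum.swap, subst (2) sum.swap, rule refl)
  also have "\<dots> = (\<Sum>i\<in>I. \<Sum>j\<in>J. \<Sum>a\<in>A. \<Sum>b\<in>B. f a b i j)"
    by (subst sum.swap, subst (2) sum.swap, rule refl)
  finally show ?thesis .
qed

text \<open>Heisenberg picture: applying \<open>M\<close> to the state amounts to transforming the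
  coefficient matrix \<open>E\<close> by \<open>M\<close> on both sides.\<close>

lemma quadratic_form_comp_matrix:
  fixes M :: "complex ^ 'q ^ 'q::finite"
  assumes "quadratic_form f"
  shows "quadratic_form (\<lambda>v. f (M *v v))"
proof -
  obtain E where E: "\<And>v.
      complex_of_real (f v) = (\<Sum>a\<in>UNIV. \<Sum>b\<in>UNIV. v $ a * cnj (v $ b) * E a b)"
    using assms unfolding quadratic_form_def by blast
  have "complex_of_real (f (M *v v)) = (\<Sum>i\<in>UNIV. \<Sum>j\<in>UNIV. v $ i * cnj (v $ j) *
      (\<Sum>a\<in>UNIV. \<Sum>b\<in>UNIV. M $ a $ i * cnj (M $ b $ j) * E a b))" for v
  proof -
    have "(M *v v) $ a * cnj ((M *v v) $ b) * E a b =
        (\<Sum>i\<in>UNIV. \<Sum>j\<in>UNIV. v $ i * cnj (v $ j) * (M $ a $ i * cnj (M $ b $ j) * E a b))" for a b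
    proof -
      have "(M *v v) $ a * cnj ((M *v v) $ b) =
          (\<Sum>i\<in>UNIV. \<Sum>j\<in>UNIV. (M $ a $ i * v $ i) * cnj (M $ b $ j * v $ j))"
        by (simp add: matrix_vector_mult_def sum_product)
      then show ?thesis by (simp add: sum_distrib_left mult_ac)
    qed
    then have "complex_of_real (f (M *v v)) =
        (\<Sum>a\<in>UNIV. \<Sum>b\<in>UNIV. \<Sum>i\<in>UNIV. \<Sum>j\<in>UNIV.
          v $ i * cnj (v $ j) * (M $ a $ i * cnj (M $ b $ j) * E a b))"
      by (simp add: E)
    also have "\<dots> = (\<Sum>i\<in>UNIV. \<Sum>j\<in>UNIV. \<Sum>a\<in>UNIV. \<Sum>b\<in>UNIV.
          v $ i * cnj (v $ j) * (M $ a $ i * cnj (M $ b $ j) * E a b))"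
      by (rule sum_swap_pairs)
    finally show ?thesis by (simp add: sum_distrib_left)
  qed
  then show ?thesis unfolding quadratic_form_def
    by (intro exI[of _ "\<lambda>i j. \<Sum>a\<in>UNIV. \<Sum>b\<in>UNIV. M $ a $ i * cnj (M $ b $ j) * E a b"]) blast
qed

lemma general_measurement_norm:
  fixes M :: "'c \<Rightarrow> complex ^ 'q ^ 'q::finite"
  assumes "general_measurement C M"
  shows "(\<Sum>c\<in>C. (norm (M c *v v))\<^sup>2) = (norm v)\<^sup>2"
proof -
  \<comment> \<open>\<open>G B\<close> is the inner product of \<open>v\<close> with
    \<open>B *v v\<close>. Being linear in \<open>B\<close>, it turns the completeness relation of
    the measurement into preservation of total probability.\<close>
  define G where "G B = (\<Sum>a\<in>UNIV. \<Sum>b\<in>UNIV. v $ a * cnj (v $ b) * B $ b $ a)"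
    for B :: "complex ^ 'q ^ 'q"
  have sumG: "(\<Sum>c\<in>C. G (B c)) = G (\<Sum>c\<in>C. B c)" for B
  proof -
    have "(\<Sum>c\<in>C. G (B c)) = (\<Sum>a\<in>UNIV. \<Sum>c\<in>C. \<Sum>b\<in>UNIV. v $ a * cnj (v $ b) * B c $ b $ a)"
      unfolding G_def by (rule sum.swap)
    also have "\<dots> = (\<Sum>a\<in>UNIV. \<Sum>b\<in>UNIV. \<Sum>c\<in>C. v $ a * cnj (v $ b) * B c $ b $ a)"
      by (intro sum.cong refl sum.swap)
    finally show ?thesis by (simp add: G_def sum_distrib_left)
  qed
  have G_norm: "complex_of_real ((norm (A *v v))\<^sup>2) = G (dagger A ** A)" for A
  proof -
    have "complex_of_real ((norm (A *v v))\<^sup>2) =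
       (\<Sum>i\<in>UNIV. \<Sum>a\<in>UNIV. \<Sum>b\<in>UNIV. v $ a * cnj (v $ b) * (cnj (A $ i $ b) * A $ i $ a))"
      unfolding of_real_norm_vec_squared
      by (simp add: matrix_vector_mult_def sum_product mult_ac)
    also have "\<dots> = (\<Sum>a\<in>UNIV. \<Sum>i\<in>UNIV. \<Sum>b\<in>UNIV.
        v $ a * cnj (v $ b) * (cnj (A $ i $ b) * A $ i $ a))"
      by (rule sum.swap)
    also have "\<dots> = (\<Sum>a\<in>UNIV. \<Sum>b\<in>UNIV. \<Sum>i\<in>UNIV.
        v $ a * cnj (v $ b) * (cnj (A $ i $ b) * A $ i $ a))"
      by (intro sum.cong refl sum.swap)
    finally show ?thesis
      by (simp add: G_def dagger_def matrix_matrix_mult_def sum_distrib_left)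
  qed
  have "complex_of_real (\<Sum>c\<in>C. (norm (M c *v v))\<^sup>2) = (\<Sum>c\<in>C. G (dagger (M c) ** M c))"
    by (simp only: of_real_sum G_norm)
  also have "\<dots> = G (mat 1)" using assms by (simp add: sumG general_measurement_def)
  also have "\<dots> = complex_of_real ((norm v)\<^sup>2)"
    unfolding of_real_norm_vec_squared G_def
    by (simp add: mat_def if_distrib cong: if_cong)
  finally show ?thesis by (simp only: of_real_eq_iff)
qed

lemma unitary_op_norm:
  fixes U :: "complex ^ 'q ^ 'q::finite"
  assumes "unitary_op U"
  shows "(norm (U *v v))\<^sup>2 = (norm v)\<^sup>2"
proof -
  have "general_measurement {()} (\<lambda>_. U)"
    using assms by (simp add: general_measurement_def unitary_op_def)
  from general_measurement_norm[OF this, of v] show ?thesis by simp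
qed

lemma projective_measurement_norm:
  fixes P :: "'c \<Rightarrow> complex ^ 'q ^ 'q::finite"
  assumes "projective_measurement C P"
  shows "(\<Sum>c\<in>C. (norm (P c *v v))\<^sup>2) = (norm v)\<^sup>2"
proof (rule general_measurement_norm)
  show "general_measurement C P"
    using assms by (simp add: projective_measurement_def general_measurement_def orthogonal_projector_def)
qed

subsection \<open>Automata with classical and quantum states\<close>

text \<open>Common form of the three models: the outcome of each step selects the next classical
  state. A quadratic form \<open>final s\<close> covers both acceptance by classical states and
  acceptance by a last measurement.\<close>

locale hybrid_automaton =
  fixes S :: "'s set" and \<Sigma> :: "'a set" and C :: "'c set"
    and M :: "'s \<Rightarrow> 'a \<Rightarrow> 'c \<Rightarrow> complex ^ 'q ^ 'q::finite"
    and \<tau> :: "'s \<Rightarrow> 'a \<Rightarrow> 'c \<Rightarrow> 's"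
    and final :: "'s \<Rightarrow> complex ^ 'q \<Rightarrow> real"
  assumes finite_states: "finite S"
    and trans: "\<And>s \<sigma> c. s \<in> S \<Longrightarrow> \<sigma> \<in> \<Sigma> \<Longrightarrow> c \<in> C \<Longrightarrow> \<tau> s \<sigma> c \<in> S"
    and meas: "\<And>s \<sigma> v. s \<in> S \<Longrightarrow> \<sigma> \<in> \<Sigma> \<Longrightarrow> (\<Sum>c\<in>C. (norm (M s \<sigma> c *v v))\<^sup>2) = (norm v)\<^sup>2"
    and final_form: "\<And>s. s \<in> S \<Longrightarrow> quadratic_form (final s)"
    and final_range: "\<And>s v. s \<in> S \<Longrightarrow> 0 \<le> final s v \<and> final s v \<le> (norm v)\<^sup>2"
begin

fun acc :: "'s \<Rightarrow> complex ^ 'q \<Rightarrow> 'a list \<Rightarrow> real" where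
  "acc s v [] = final s v"
| "acc s v (\<sigma> # x) = (\<Sum>c\<in>C. acc (\<tau> s \<sigma> c) (M s \<sigma> c *v v) x)"

text \<open>The unnormalized density matrix attached to \<open>s'\<close>: pure-state matrices are
  added over all outcome words leading from \<open>s\<close> to \<open>s'\<close>, so for a unit
  vector \<open>v\<close> its trace is the probability of being in \<open>s'\<close>.\<close>

fun density :: "'s \<Rightarrow> complex ^ 'q \<Rightarrow> 'a list \<Rightarrow> 's \<Rightarrow> 'q \<Rightarrow> 'q \<Rightarrow> complex" where
  "density s v [] s' a b = (if s' = s then v $ a * cnj (v $ b) else 0)"
| "density s v (\<sigma> # x) s' a b = (\<Sum>c\<in>C. density (\<tau> s \<sigma> c) (M s \<sigma> c *v v) x s' a b)"

lemma acc_range: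
  "s \<in> S \<Longrightarrow> x \<in> lists \<Sigma> \<Longrightarrow> 0 \<le> acc s v x \<and> acc s v x \<le> (norm v)\<^sup>2"
proof (induction x arbitrary: s v)
  case Nil
  then show ?case using final_range by simp
next
  case (Cons \<sigma> x)
  have IH: "0 \<le> acc (\<tau> s \<sigma> c) (M s \<sigma> c *v v) x \<and>
      acc (\<tau> s \<sigma> c) (M s \<sigma> c *v v) x \<le> (norm (M s \<sigma> c *v v))\<^sup>2" if "c \<in> C" for c
    using Cons trans that by auto
  have "acc s v (\<sigma> # x) \<le> (\<Sum>c\<in>C. (norm (M s \<sigma> c *v v))\<^sup>2)"
    using IH by (auto intro: sum_mono)
  then show ?case using IH meas Cons.prems by (auto intro: sum_nonneg)
qed

lemma acc_form: "s \<in> S \<Longrightarrow> x \<in> lists \<Sigma> \<Longrightarrow> quadratic_form (\<lambda>v. acc s v x)"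
proof (induction x arbitrary: s)
  case Nil
  then show ?case using final_form by simp
next
  case (Cons \<sigma> x)
  have "quadratic_form (\<lambda>v. acc (\<tau> s \<sigma> c) (M s \<sigma> c *v v) x)" if "c \<in> C" for c
    by (rule quadratic_form_comp_matrix[of "\<lambda>v. acc (\<tau> s \<sigma> c) v x"])
      (use Cons trans that in auto)
  then show ?case by (simp add: quadratic_form_sum)
qed

text \<open>The induction peels letters off \<open>x\<close> only. The coefficients \<open>E\<close>
  of the suffix \<open>z\<close> stay fixed, while sums over outcomes accumulate in the density
  family.\<close>

lemma acc_append:
  assumes E: "\<And>s v. s \<in> S \<Longrightarrow>
      complex_of_real (acc s v z) = (\<Sum>a\<in>UNIV. \<Sum>b\<in>UNIV. v $ a * cnj (v $ b) * E s a b)"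
  shows "s \<in> S \<Longrightarrow> x \<in> lists \<Sigma> \<Longrightarrow> complex_of_real (acc s v (x @ z)) =
    (\<Sum>(s', a, b)\<in>S \<times> UNIV \<times> UNIV. density s v x s' a b * E s' a b)"
proof (induction x arbitrary: s v)
  case Nil
  have "(\<Sum>(s', a, b)\<in>S \<times> UNIV \<times> UNIV. density s v [] s' a b * E s' a b) =
      (\<Sum>s'\<in>S. if s' = s then \<Sum>a\<in>UNIV. \<Sum>b\<in>UNIV. v $ a * cnj (v $ b) * E s a b else 0)"
    unfolding sum.cartesian_product[symmetric] by (intro sum.cong refl) auto
  then show ?case using Nil finite_states E by simp
next
  case (Cons \<sigma> x)
  have "complex_of_real (acc s v ((\<sigma> # x) @ z)) =
      (\<Sum>c\<in>C. \<Sum>(s', a, b)\<in>S \<times> UNIV \<times> UNIV.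
        density (\<tau> s \<sigma> c) (M s \<sigma> c *v v) x s' a b * E s' a b)"
    using Cons trans by simp
  also have "\<dots> = (\<Sum>(s', a, b)\<in>S \<times> UNIV \<times> UNIV. \<Sum>c\<in>C.
        density (\<tau> s \<sigma> c) (M s \<sigma> c *v v) x s' a b * E s' a b)"
    unfolding case_prod_beta by (rule sum.swap)
  finally show ?case by (simp add: sum_distrib_right)
qed

lemma acc_factorization:
  assumes "s \<in> S"
  obtains \<psi> \<phi> :: "'a list \<Rightarrow> 's \<times> 'q \<times> 'q \<times> bool \<Rightarrow> real" where
    "\<And>x z. x \<in> lists \<Sigma> \<Longrightarrow> z \<in> lists \<Sigma> \<Longrightarrow>
       acc s v (x @ z) = (\<Sum>i\<in>S \<times> UNIV. \<psi> x i * \<phi> z i)"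
proof -
  \<comment> \<open>One coefficient matrix is fixed for each suffix and state, independently of
    \<open>v\<close>, so that the second factor depends on \<open>z\<close> alone.\<close>
  define E where "E z s = (SOME E. \<forall>v. complex_of_real (acc s v z) =
      (\<Sum>a\<in>UNIV. \<Sum>b\<in>UNIV. v $ a * cnj (v $ b) * E a b))" for z s
  have E: "complex_of_real (acc s v z) =
      (\<Sum>a\<in>UNIV. \<Sum>b\<in>UNIV. v $ a * cnj (v $ b) * E z s a b)"
    if "z \<in> lists \<Sigma>" "s \<in> S" for z s v
    using someI_ex[OF acc_form[OF that(2,1), unfolded quadratic_form_def]] unfolding E_def by blast
  \<comment> \<open>Real coordinates: the real part of a product is Re Re - Im Im. The boolean index
    selects the summand and doubles the dimension; the minus sign is put into
    \<open>\<psi>\<close>.\<close>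
  define \<psi> where "\<psi> = (\<lambda>x (s', a, b, r).
     if r then Re (density s v x s' a b) else - Im (density s v x s' a b))"
  define \<phi> where "\<phi> = (\<lambda>z (s', a, b, r). if r then Re (E z s' a b) else Im (E z s' a b))"
  have "acc s v (x @ z) = (\<Sum>i\<in>S \<times> UNIV. \<psi> x i * \<phi> z i)"
    if "x \<in> lists \<Sigma>" "z \<in> lists \<Sigma>" for x z
  proof -
    have "acc s v (x @ z) = Re (complex_of_real (acc s v (x @ z)))" by simp
    also have "\<dots> = (\<Sum>(s', a, b)\<in>S \<times> UNIV \<times> UNIV. Re (density s v x s' a b * E z s' a b))"
      by (subst acc_append[of z "E z"]) (use E assms that in \<open>auto simp: case_prod_beta\<close>)
    also have "\<dots> = (\<Sum>(s', a, b)\<in>S \<times> UNIV \<times> UNIV. \<Sum>r\<in>UNIV. \<psi> x (s', a, b, r) * \<phi> z (s', a, b, r))"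
      by (intro sum.cong refl) (auto simp: UNIV_bool \<psi>_def \<phi>_def)
    also have "\<dots> = (\<Sum>s'\<in>S. \<Sum>a\<in>UNIV. \<Sum>b\<in>UNIV. \<Sum>r\<in>UNIV. \<psi> x (s', a, b, r) * \<phi> z (s', a, b, r))"
      by (simp only: sum.cartesian_product' prod.case)
    also have "\<dots> = (\<Sum>i\<in>S \<times> UNIV \<times> UNIV \<times> UNIV. \<psi> x i * \<phi> z i)"
      by (simp only: sum.cartesian_product')
    also have "S \<times> UNIV \<times> UNIV \<times> UNIV = S \<times> (UNIV :: ('q \<times> 'q \<times> bool) set)" by simp
    finally show ?thesis .
  qed
  then show thesis using that by blast
qed

end

lemma (in hybrid_automaton) distinguishable_words_bound:
  fixes \<delta> :: real
  assumes s: "s \<in> S" and v: "norm v = 1" and X: "finite X" "X \<subseteq> lists \<Sigma>"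
    and \<delta>: "0 < \<delta>" "\<delta> \<le> 1/2"
    and sep: "\<And>x y. x \<in> X \<Longrightarrow> y \<in> X \<Longrightarrow> x \<noteq> y \<Longrightarrow>
      \<exists>z\<in>lists \<Sigma>. 2 * \<delta> \<le> \<bar>acc s v (x @ z) - acc s v (y @ z)\<bar>"
  shows "real (card X) \<le> (2 / \<delta>) ^ (2 * card S * CARD('q)\<^sup>2)"
proof -
  obtain \<psi> \<phi> :: "'a list \<Rightarrow> 's \<times> 'q \<times> 'q \<times> bool \<Rightarrow> real" where fact:
    "\<And>x z. x \<in> lists \<Sigma> \<Longrightarrow> z \<in> lists \<Sigma> \<Longrightarrow> acc s v (x @ z) = (\<Sum>i\<in>S \<times> UNIV. \<psi> x i * \<phi> z i)"
    using acc_factorization[OF s] by metis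
  \<comment> \<open>One separating suffix per pair is enough, which yields the finite set of
    suffixes that the counting argument requires.\<close>
  have "\<forall>(x, y)\<in>{(x, y). x \<in> X \<and> y \<in> X \<and> x \<noteq> y}. \<exists>z. z \<in> lists \<Sigma> \<and>
      2 * \<delta> \<le> \<bar>acc s v (x @ z) - acc s v (y @ z)\<bar>"
    using sep by blast
  then obtain w where w: "\<And>x y. x \<in> X \<Longrightarrow> y \<in> X \<Longrightarrow> x \<noteq> y \<Longrightarrow> w (x, y) \<in> lists \<Sigma> \<and>
      2 * \<delta> \<le> \<bar>acc s v (x @ w (x, y)) - acc s v (y @ w (x, y))\<bar>"
    unfolding case_prod_beta by (metis (mono_tags, lifting) case_prodI fst_conv mem_Collect_eq snd_conv)
  define Z where "Z = w ` {(x, y). x \<in> X \<and> y \<in> X \<and> x \<noteq> y}"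
  have Z: "finite Z" "Z \<subseteq> lists \<Sigma>"
  proof -
    have "{(x, y). x \<in> X \<and> y \<in> X \<and> x \<noteq> y} \<subseteq> X \<times> X" by auto
    then show "finite Z" unfolding Z_def by (meson X finite_SigmaI finite_imageI finite_subset)
    show "Z \<subseteq> lists \<Sigma>" using w unfolding Z_def by blast
  qed
  have "real (card X) \<le> (2 / \<delta>) ^ card (S \<times> (UNIV :: ('q \<times> 'q \<times> bool) set))"
  proof (rule separated_rows_bound[OF X(1) Z(1) _ \<delta>, where P = "\<lambda>x z. acc s v (x @ z)"])
    show "finite (S \<times> (UNIV :: ('q \<times> 'q \<times> bool) set))" using finite_states by simp
    show "acc s v (x @ z) = (\<Sum>i\<in>S \<times> UNIV. \<psi> x i * \<phi> z i)" if "x \<in> X" "z \<in> Z" for x z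
      using fact that X Z by blast
    show "0 \<le> acc s v (x @ z) \<and> acc s v (x @ z) \<le> 1" if "x \<in> X" "z \<in> Z" for x z
    proof -
      have "x @ z \<in> lists \<Sigma>" using that X Z by auto
      from acc_range[OF s this, of v] show ?thesis using v by simp
    qed
    show "\<exists>z\<in>Z. 2 * \<delta> \<le> \<bar>acc s v (x @ z) - acc s v (y @ z)\<bar>"
      if "x \<in> X" "y \<in> X" "x \<noteq> y" for x y
      using w[OF that] that unfolding Z_def by blast
  qed
  also have "card (S \<times> (UNIV :: ('q \<times> 'q \<times> bool) set)) = 2 * card S * CARD('q)\<^sup>2"
    by (simp add: card_cartesian_product power2_eq_square flip: UNIV_Times_UNIV)
  finally show ?thesis .
qed

subsection \<open>Reduction of the three models\<close>

lemma sum_lists_length_Suc: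
  "(\<Sum>cs | cs \<in> lists C \<and> length cs = Suc n. f cs) =
   (\<Sum>c\<in>C. \<Sum>cs | cs \<in> lists C \<and> length cs = n. f (c # cs))"
proof -
  have "(\<Sum>(c, cs)\<in>C \<times> {cs. cs \<in> lists C \<and> length cs = n}. f (c # cs)) =
      (\<Sum>cs | cs \<in> lists C \<and> length cs = Suc n. f cs)"
    by (rule sum.reindex_bij_witness[where i = "\<lambda>cs. (hd cs, tl cs)" and j = "\<lambda>(c, cs). c # cs"])
      (auto simp: length_Suc_conv)
  then show ?thesis by (simp add: sum.cartesian_product)
qed

lemma sum_lists_length_0: "(\<Sum>cs | cs \<in> lists C \<and> length cs = 0. f cs) = f []"
proof -
  have "{cs. cs \<in> lists C \<and> length cs = 0} = {[]}" by auto
  then show ?thesis by simp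
qed

text \<open>The run from an arbitrary classical state, needed for induction on the first
  letter.\<close>

definition qcfa_run_from where
  "qcfa_run_from A s x cs i = foldl (\<lambda>s (\<sigma>, c). qcfa_trans A s \<sigma> c) s (take i (zip x cs))"

lemma qcfa_prob_eq_acc:
  fixes A :: "('q::finite, 's, 'a, 'c) qcfa"
  assumes "is_qcfa A"
  defines "final \<equiv> \<lambda>s v. if s \<in> qcfa_accepting A then (norm v)\<^sup>2 else 0"
  shows "hybrid_automaton (qcfa_states A) (qcfa_alphabet A) (qcfa_outcomes A)
      (qcfa_meas A) (qcfa_trans A) final" (is ?hybrid)
    and "qcfa_prob A x = hybrid_automaton.acc (qcfa_outcomes A) (qcfa_meas A) (qcfa_trans A) final
      (qcfa_init A) (ket (qcfa_qinit A)) x"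
proof -
  show H: ?hybrid
  proof
    show "quadratic_form (final s)" for s
      unfolding final_def
      by (cases "s \<in> qcfa_accepting A")
        (simp_all add: quadratic_form_norm_squared quadratic_form_zero)
  qed (use assms(1) in \<open>auto simp: is_qcfa_def final_def intro!: general_measurement_norm\<close>)
  interpret hybrid_automaton "qcfa_states A" "qcfa_alphabet A" "qcfa_outcomes A"
    "qcfa_meas A" "qcfa_trans A" final by (rule H)
  \<comment> \<open>The claim is generalized over \<open>s\<close> and \<open>v\<close>, since the
    first outcome changes both.\<close>
  have "(\<Sum>cs | cs \<in> lists (qcfa_outcomes A) \<and> length cs = length x.
        indicator (qcfa_accepting A) (qcfa_run_from A s x cs (length x)) *
        (norm (ordered_prod
          (map (\<lambda>i. qcfa_meas A (qcfa_run_from A s x cs i) (x ! i) (cs ! i)) [0..<length x])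
            *v v))\<^sup>2) = acc s v x" for s v x
  proof (induction x arbitrary: s v)
    case Nil
    show ?case
      unfolding list.size sum_lists_length_0 acc.simps by (simp add: qcfa_run_from_def final_def)
  next
    case (Cons \<sigma> x)
    \<comment> \<open>Splitting off index 0 isolates the operator that acts first; the shifted
      indices describe the run on the rest of the input.\<close>
    have "map f [0..<length (\<sigma> # x)] = f 0 # map (\<lambda>i. f (Suc i)) [0..<length x]"
      for f :: "nat \<Rightarrow> complex ^ 'q ^ 'q"
      by (simp add: upt_conv_Cons map_Suc_upt[symmetric] del: upt_Suc)
    then have "ordered_prod (map (\<lambda>i. qcfa_meas A (qcfa_run_from A s (\<sigma> # x) (c # cs) i)
          ((\<sigma> # x) ! i) ((c # cs) ! i)) [0..<length (\<sigma> # x)]) *v v =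
        ordered_prod (map (\<lambda>i. qcfa_meas A (qcfa_run_from A (qcfa_trans A s \<sigma> c) x cs i)
          (x ! i) (cs ! i)) [0..<length x]) *v (qcfa_meas A s \<sigma> c *v v)" for c cs
      by (simp only:) (simp add: qcfa_run_from_def matrix_vector_mul_assoc)
    moreover have "qcfa_run_from A s (\<sigma> # x) (c # cs) (length (\<sigma> # x)) =
        qcfa_run_from A (qcfa_trans A s \<sigma> c) x cs (length x)" for c cs
      by (simp add: qcfa_run_from_def)
    ultimately show ?case
      unfolding list.size(4) add_Suc_right add_0_right sum_lists_length_Suc acc.simps
      by (simp add: Cons.IH del: upt_Suc)
  qed
  from this[where s = "qcfa_init A" and v = "ket (qcfa_qinit A)"]
  show "qcfa_prob A x = acc (qcfa_init A) (ket (qcfa_qinit A)) x"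
    by (simp add: qcfa_prob_def qcfa_run_def qcfa_run_from_def)
qed

text \<open>The classical part is deterministic, so each unitary is a measurement with the single
  outcome \<open>()\<close>, and the accepting projector enters through
  \<open>final\<close>.\<close>

lemma qfac_prob_eq_acc:
  fixes A :: "('q::finite, 's, 'a) qfac"
  assumes "is_qfac A"
  defines "final \<equiv> \<lambda>s v. (norm (qfac_proj A s Accept *v v))\<^sup>2"
    and "M \<equiv> \<lambda>s \<sigma> _. qfac_unitary A s \<sigma>" and "\<tau> \<equiv> \<lambda>s \<sigma> _. qfac_trans A s \<sigma>"
  shows "hybrid_automaton (qfac_states A) (qfac_alphabet A) {()} M \<tau> final" (is ?hybrid)
    and "qfac_prob A x = hybrid_automaton.acc {()} M \<tau> final
      (qfac_init A) (ket (qfac_qinit A)) x"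
proof -
  show H: ?hybrid
  proof
    show "quadratic_form (final s)" for s
      unfolding final_def
      by (rule quadratic_form_comp_matrix) (rule quadratic_form_norm_squared)
    show "0 \<le> final s v \<and> final s v \<le> (norm v)\<^sup>2" if "s \<in> qfac_states A" for s v
    proof -
      have "projective_measurement {Accept, Reject} (qfac_proj A s)"
        using assms(1) that by (auto simp: is_qfac_def)
      from projective_measurement_norm[OF this, of v]
      have "(norm (qfac_proj A s Accept *v v))\<^sup>2 + (norm (qfac_proj A s Reject *v v))\<^sup>2 = (norm v)\<^sup>2"
        by simp
      then show ?thesis
        using zero_le_power2[of "norm (qfac_proj A s Accept *v v)"]
          zero_le_power2[of "norm (qfac_proj A s Reject *v v)"]
        unfolding final_def by linarith
    qed
  qed (use assms(1) in \<open>auto simp: is_qfac_def M_def \<tau>_def unitary_op_norm\<close>)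
  interpret hybrid_automaton "qfac_states A" "qfac_alphabet A" "{()}" M \<tau> final by (rule H)
  have "(norm ((qfac_proj A (foldl (qfac_trans A) s (take (length x) x)) Accept **
        ordered_prod (map (\<lambda>i. qfac_unitary A (foldl (qfac_trans A) s (take i x)) (x ! i))
          [0..<length x])) *v v))\<^sup>2 = acc s v x" for s v x
  proof (induction x arbitrary: s v)
    case Nil
    show ?case unfolding acc.simps by (simp add: final_def)
  next
    case (Cons \<sigma> x)
    have "map f [0..<length (\<sigma> # x)] = f 0 # map (\<lambda>i. f (Suc i)) [0..<length x]"
      for f :: "nat \<Rightarrow> complex ^ 'q ^ 'q"
      by (simp add: upt_conv_Cons map_Suc_upt[symmetric] del: upt_Suc)
    then show ?case using Cons.IH[of "qfac_trans A s \<sigma>" "qfac_unitary A s \<sigma> *v v"]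
      by (simp only: acc.simps) (simp add: M_def \<tau>_def matrix_vector_mul_assoc matrix_mul_assoc)
  qed
  from this[where s = "qfac_init A" and v = "ket (qfac_qinit A)"]
  show "qfac_prob A x = acc (qfac_init A) (ket (qfac_qinit A)) x"
    by (simp add: qfac_prob_def qfac_run_def)
qed

text \<open>A DFA for the control language runs alongside and reads the measurement outcomes as its
  input; its states become the classical states.\<close>

lemma cl_prob_eq_acc:
  fixes A :: "('q::finite, 'a, 'c) cl_qfa" and D :: "(nat, 'c) dfa"
  assumes A: "is_cl_qfa A" and D: "is_dfa D" "dfa_alphabet D = cl_outcomes A"
    "dfa_language D = cl_control A"
  defines "final \<equiv> \<lambda>s v. if s \<in> dfa_accepting D then (norm v)\<^sup>2 else 0"
    and "M \<equiv> \<lambda>s \<sigma> c. cl_proj A c ** cl_unitary A \<sigma>" and "\<tau> \<equiv> \<lambda>s \<sigma> c. dfa_trans D s c"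
  shows "hybrid_automaton (dfa_states D) (cl_alphabet A) (cl_outcomes A) M \<tau> final" (is ?hybrid)
    and "cl_prob A x = hybrid_automaton.acc (cl_outcomes A) M \<tau> final
      (dfa_init D) (ket (cl_init A)) x"
proof -
  show H: ?hybrid
  proof
    show "quadratic_form (final s)" for s
      unfolding final_def
      by (cases "s \<in> dfa_accepting D")
        (simp_all add: quadratic_form_norm_squared quadratic_form_zero)
    show "(\<Sum>c\<in>cl_outcomes A. (norm (M s \<sigma> c *v v))\<^sup>2) = (norm v)\<^sup>2"
      if "\<sigma> \<in> cl_alphabet A" for s \<sigma> v
    proof -
      have "projective_measurement (cl_outcomes A) (cl_proj A)" "unitary_op (cl_unitary A \<sigma>)"
        using A that by (auto simp: is_cl_qfa_def)
      then show ?thesis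
        by (simp add: M_def projective_measurement_norm unitary_op_norm
            flip: matrix_vector_mul_assoc)
    qed
  qed (use D in \<open>auto simp: is_dfa_def final_def \<tau>_def\<close>)
  interpret hybrid_automaton "dfa_states D" "cl_alphabet A" "cl_outcomes A" M \<tau> final
    by (rule H)
  have "(\<Sum>y | y \<in> lists (cl_outcomes A) \<and> length y = length x.
        indicator (dfa_accepting D) (foldl (dfa_trans D) s y) *
        (norm (ordered_prod (map2 (\<lambda>c \<sigma>. cl_proj A c ** cl_unitary A \<sigma>) y x) *v v))\<^sup>2) =
      acc s v x" for s v x
  proof (induction x arbitrary: s v)
    case Nil
    show ?case unfolding list.size sum_lists_length_0 acc.simps by (simp add: final_def)
  next
    case (Cons \<sigma> x)
    show ?case
      unfolding list.size(4) add_Suc_right add_0_right sum_lists_length_Suc acc.simps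
      by (simp add: Cons.IH[symmetric])
        (simp add: M_def \<tau>_def flip: matrix_vector_mul_assoc)
  qed
  note eq = this[where s = "dfa_init D" and v = "ket (cl_init A)" and x = x]
  \<comment> \<open>Finiteness allows the sum over the control language to be extended to all
    outcome words, the added ones having indicator 0.\<close>
  have "finite {y. y \<in> lists (cl_outcomes A) \<and> length y = length x}"
    using finite_lists_length_eq[of "cl_outcomes A" "length x"] A
    by (simp add: is_cl_qfa_def lists_eq_set)
  then have "cl_prob A x = (\<Sum>y | y \<in> lists (cl_outcomes A) \<and> length y = length x.
        indicator (dfa_accepting D) (foldl (dfa_trans D) (dfa_init D) y) *
        (norm (ordered_prod (map2 (\<lambda>c \<sigma>. cl_proj A c ** cl_unitary A \<sigma>) y x)
          *v ket (cl_init A)))\<^sup>2)"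
    unfolding cl_prob_def D(3)[symmetric]
    by (intro sum.mono_neutral_cong_left) (auto simp: dfa_language_def D(2) indicator_def)
  then show "cl_prob A x = acc (dfa_init D) (ket (cl_init A)) x" using eq by simp
qed

subsection \<open>The lower bound\<close>

text \<open>The member lies at least \<delta> above the cut-point and the non-member at least
  \<delta> below it, so the two gaps add up.\<close>

lemma recognizes_isolated_separates:
  assumes "recognizes_isolated A L \<delta>" "x \<in> lists (sq_alphabet A)" "y \<in> lists (sq_alphabet A)"
    "(x \<in> L) \<noteq> (y \<in> L)"
  shows "2 * \<delta> \<le> \<bar>accept_prob A x - accept_prob A y\<bar>"
proof -
  obtain cut where cut: "\<And>x. x \<in> L \<Longrightarrow> accept_prob A x > cut"
    "\<And>x. x \<in> lists (sq_alphabet A) - L \<Longrightarrow> accept_prob A x \<le> cut"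
    "\<And>x. x \<in> lists (sq_alphabet A) \<Longrightarrow> \<bar>accept_prob A x - cut\<bar> \<ge> \<delta>"
    using assms(1) unfolding recognizes_isolated_def by blast
  note gaps = cut(3)[OF assms(2)] cut(3)[OF assms(3)]
  show ?thesis
  proof (cases "x \<in> L")
    case True
    then show ?thesis using cut(1)[of x] cut(2)[of y] gaps assms(3,4) by auto
  next
    case False
    then show ?thesis using cut(1)[of y] cut(2)[of x] gaps assms(2,4) by auto
  qed
qed

lemma min_dfa_states_le:
  fixes A :: "('q::finite, 's, 'a, 'c) semi_quantum"
  assumes sq: "is_semi_quantum A" and reg: "regular_over (sq_alphabet A) L"
    and rec: "recognizes_isolated A L \<delta>"
  shows "real (min_dfa_states (sq_alphabet A) L)
      \<le> (2 / \<delta>) ^ (2 * classical_states A * CARD('q)\<^sup>2)"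
    and "0 < classical_states A"
proof -
  obtain X where X: "finite X" "X \<subseteq> lists (sq_alphabet A)"
    "min_dfa_states (sq_alphabet A) L \<le> card X"
    and dist: "\<And>x y. x \<in> X \<Longrightarrow> y \<in> X \<Longrightarrow> x \<noteq> y \<Longrightarrow>
       \<exists>z\<in>lists (sq_alphabet A). (x @ z \<in> L) \<noteq> (y @ z \<in> L)"
    using distinguishable_words[OF reg] by metis
  have \<delta>: "0 < \<delta>" "\<delta> \<le> 1/2" using rec by (auto simp: recognizes_isolated_def)
  have sep: "\<exists>z\<in>lists (sq_alphabet A). 2 * \<delta> \<le> \<bar>accept_prob A (x @ z) - accept_prob A (y @ z)\<bar>"
    if "x \<in> X" "y \<in> X" "x \<noteq> y" for x y
  proof -
    obtain z where z: "z \<in> lists (sq_alphabet A)" "(x @ z \<in> L) \<noteq> (y @ z \<in> L)"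
      using dist \<open>x \<in> X\<close> \<open>y \<in> X\<close> \<open>x \<noteq> y\<close> by blast
    then have "2 * \<delta> \<le> \<bar>accept_prob A (x @ z) - accept_prob A (y @ z)\<bar>"
      using X(2) \<open>x \<in> X\<close> \<open>y \<in> X\<close> by (intro recognizes_isolated_separates[OF rec]) auto
    then show ?thesis using z(1) by blast
  qed
  have "real (card X) \<le> (2 / \<delta>) ^ (2 * classical_states A * CARD('q)\<^sup>2) \<and> 0 < classical_states A"
  proof (cases A)
    case (CL_1QFA B)
    then have B: "is_cl_qfa B" "regular_over (cl_outcomes B) (cl_control B)"
      using sq by (auto simp: is_cl_qfa_def)
    \<comment> \<open>A minimal DFA is taken so that its number of states is exactly
      \<open>classical_states A\<close>.\<close>
    then obtain D :: "(nat, 'c) dfa" where D: "is_dfa D" "dfa_alphabet D = cl_outcomes B"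
      "dfa_language D = cl_control B"
      "card (dfa_states D) = min_dfa_states (cl_outcomes B) (cl_control B)"
      using minimal_dfa by metis
    note H = cl_prob_eq_acc[OF B(1) D(1-3)]
    show ?thesis
      using hybrid_automaton.distinguishable_words_bound[OF H(1), of "dfa_init D" "ket (cl_init B)" X \<delta>]
        X(1,2) \<delta> sep D is_dfa_card_pos[OF D(1)]
      by (simp add: CL_1QFA H(2) is_dfa_def)
  next
    case (QFAC B)
    then have B: "is_qfac B" using sq by simp
    note H = qfac_prob_eq_acc[OF B]
    show ?thesis
      using hybrid_automaton.distinguishable_words_bound[OF H(1), of "qfac_init B" "ket (qfac_qinit B)" X \<delta>]
        X(1,2) \<delta> sep B
      by (auto simp: QFAC H(2) is_qfac_def card_gt_0_iff)
  next
    case (QCFA B)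
    then have B: "is_qcfa B" using sq by simp
    note H = qcfa_prob_eq_acc[OF B]
    show ?thesis
      using hybrid_automaton.distinguishable_words_bound[OF H(1), of "qcfa_init B" "ket (qcfa_qinit B)" X \<delta>]
        X(1,2) \<delta> sep B
      by (auto simp: QCFA H(2) is_qcfa_def card_gt_0_iff)
  qed
  then show "real (min_dfa_states (sq_alphabet A) L)
      \<le> (2 / \<delta>) ^ (2 * classical_states A * CARD('q)\<^sup>2)" "0 < classical_states A"
    using X(3) by auto
qed

theorem theorem11:
  fixes A :: "('q::finite, 's, 'a, 'c) semi_quantum"
    and L :: "'a list set" and \<delta> :: real and q k d :: nat
  assumes "is_semi_quantum A"
    and "q = quantum_states A" and "k = classical_states A"
    and "regular_over (sq_alphabet A) L"
    and "d = min_dfa_states (sq_alphabet A) L"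
    and "recognizes_isolated A L \<delta>"
  shows "real (q * k) \<ge> (log 2 (real d) / (2 * log 2 (2 / \<delta>))) powr (4 / 9)"
proof -
  have \<delta>: "0 < \<delta>" "\<delta> \<le> 1/2" using assms(6) by (auto simp: recognizes_isolated_def)
  define l where "l = log 2 (2 / \<delta>)"
  have l: "0 < l" using \<delta> by (simp add: l_def)
  have q: "q = CARD('q)" "0 < q" using assms(2) by (simp_all add: quantum_states_def)
  have k: "0 < k" and d: "real d \<le> (2 / \<delta>) ^ (2 * k * q\<^sup>2)"
    using min_dfa_states_le[OF assms(1,4,6)] by (simp_all add: assms(3,5) q)
  have "0 < d"
    using minimal_dfa[OF assms(4)] is_dfa_card_pos assms(5) by metis
  have "log 2 d \<le> log 2 ((2 / \<delta>) ^ (2 * k * q\<^sup>2))"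
    using d \<open>0 < d\<close> \<delta> by simp
  also have "\<dots> = (2 * k * q\<^sup>2) * l" using \<delta> by (simp add: l_def log_nat_power)
  \<comment> \<open>The 2 in the denominator cancels the factor 2 that comes from counting real
    dimensions.\<close>
  finally have "log 2 d / (2 * l) \<le> k * q\<^sup>2" using l by (simp add: pos_divide_le_eq)
  \<comment> \<open>Bounding \<open>k\<close> by its square makes the estimate depend on the product
    alone. A square root would already give exponent 1/2, so 4/9 leaves room.\<close>
  also have "\<dots> \<le> real (q * k) powr 2"
  proof -
    have "k * q\<^sup>2 * 1 \<le> k * q\<^sup>2 * k" using k by (intro mult_left_mono) auto
    then have "k * q\<^sup>2 \<le> (q * k)\<^sup>2" by (simp add: power2_eq_square mult_ac)
    then have "real (k * q\<^sup>2) \<le> real ((q * k)\<^sup>2)" by (simp only: of_nat_le_iff)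
    then show ?thesis using k q by (simp add: powr_numeral)
  qed
  finally have "(log 2 d / (2 * l)) powr (4 / 9) \<le> (real (q * k) powr 2) powr (4 / 9)"
    using l \<open>0 < d\<close> by (intro powr_mono2) auto
  also have "\<dots> = real (q * k) powr (8 / 9)" by (subst powr_powr) simp
  \<comment> \<open>Raising the exponent from 8/9 to 1 is allowed because the product is at least
    1.\<close>
  also have "\<dots> \<le> real (q * k) powr 1"
  proof (rule powr_mono)
    have "1 \<le> q * k" using k q(2) by simp
    from of_nat_mono[OF this] show "1 \<le> real (q * k)" by (simp only: of_nat_1)
  qed simp
  finally show ?thesis unfolding l_def by (simp only: powr_one of_nat_0_le_iff)
qed

end
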